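(* Let $0\le\alpha\le1$. If $f\in\mathcal{BK}(\alpha)$, then $\|P_f\|\le1$, and the estimate is sharp, i.e. there is a function $g\in\mathcal{BK}(\alpha)$ with $\|P_g\|=1$.
   Context: $\mathbb{D}=\{z\in\mathbb{C}:|z|<1\}$. $\mathcal{A}$ is the class of analytic functions $f$ in $\mathbb{D}$ with $f(0)=0$, $f'(0)=1$. For analytic $f,g$ in $\mathbb{D}$, $f$ is subordinate to $g$, written $f\prec g$, if there is an analytic $\omega:\mathbb{D}\to\mathbb{D}$ with $\omega(0)=0$ and $f(z)=g(\omega(z))$ for all $z\in\mathbb{D}$. For $0\le\alpha\le1$ let $F_\alpha(z)=\dfrac{z}{1-\alpha z^2}$, and let $\mathcal{BK}(\alpha)$ be the class of $f\in\mathcal{A}$ such that $\dfrac{zf''(z)}{f'(z)}\prec F_\alpha(z)$ (in particular $zf''/f'$ is analytic in $\mathbb{D}$). For a locally univalent analytic function $f$ in $\mathbb{D}$, the pre-Schwarzian derivative is $P_f(z)=f''(z)/f'(z)$ and the pre-Schwarzian norm is $\|P_f\|=\sup_{z\in\mathbb{D}}(1-|z|^2)|P_f(z)|$. *)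

theory Defs
  imports "HOL-Complex_Analysis.Complex_Analysis"
begin

abbreviation unit_disc :: "complex set" where
  "unit_disc \<equiv> ball 0 1"

definition class_A :: "(complex \<Rightarrow> complex) set" where
  "class_A = {f. f holomorphic_on unit_disc \<and> f 0 = 0 \<and> deriv f 0 = 1}"

definition subordinate :: "(complex \<Rightarrow> complex) \<Rightarrow> (complex \<Rightarrow> complex) \<Rightarrow> bool"
    (infix \<open>\<prec>\<^sub>s\<close> 50) where
  "f \<prec>\<^sub>s g \<longleftrightarrow> f holomorphic_on unit_disc \<and> g holomorphic_on unit_disc \<and>
     (\<exists>\<omega>. \<omega> holomorphic_on unit_disc \<and> \<omega> ` unit_disc \<subseteq> unit_disc \<and> \<omega> 0 = 0 \<and>
          (\<forall>z\<in>unit_disc. f z = g (\<omega> z)))"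

definition F :: "real \<Rightarrow> complex \<Rightarrow> complex" where
  "F \<alpha> z = z / (1 - of_real \<alpha> * z\<^sup>2)"

definition pre_schwarzian :: "(complex \<Rightarrow> complex) \<Rightarrow> complex \<Rightarrow> complex" where
  "pre_schwarzian f z = deriv (deriv f) z / deriv f z"

(* The supremum is taken in the extended reals, so that it is infinite, rather than
   unspecified, when the set of values is unbounded. *)
definition pre_schwarzian_norm :: "(complex \<Rightarrow> complex) \<Rightarrow> ereal" where
  "pre_schwarzian_norm f =
     (SUP z\<in>unit_disc. ereal ((1 - (cmod z)\<^sup>2) * cmod (pre_schwarzian f z)))"

(* The convention x / 0 = 0 plays no role here: subordination requires the quotient to be
   holomorphic on the disc, and this excludes zeros of the derivative; see BK_deriv_nonzero. *)
definition BK :: "real \<Rightarrow> (complex \<Rightarrow> complex) set" where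
  "BK \<alpha> = {f \<in> class_A. (\<lambda>z. z * deriv (deriv f) z / deriv f z) \<prec>\<^sub>s F \<alpha>}"

lemma BK_deriv_nonzero:
  assumes "f \<in> BK \<alpha>" and z0: "z0 \<in> unit_disc"
  shows "deriv f z0 \<noteq> 0"
proof
  assume zero: "deriv f z0 = 0"
  define g where "g = deriv f"
  define h where "h = (\<lambda>z. z * deriv g z / g z)"
  have f: "f holomorphic_on unit_disc" and g0: "g 0 = 1" and h: "h holomorphic_on unit_disc"
    using assms(1) unfolding BK_def class_A_def subordinate_def g_def h_def by auto
  have g: "g holomorphic_on unit_disc"
    unfolding g_def by (intro holomorphic_deriv f) auto
  have gz: "g z0 = 0" using zero by (simp add: g_def)
  have cont: "isCont u z" if "u holomorphic_on S" "open S" "z \<in> S" for u :: "complex \<Rightarrow> complex" and S z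
    using that holomorphic_on_imp_continuous_on continuous_on_eq_continuous_at by blast
  have z0n: "z0 \<noteq> 0" using gz g0 by auto
  have "\<not> g constant_on unit_disc"
    using gz g0 z0 unfolding constant_on_def by (metis centre_in_ball zero_less_one zero_neq_one)
  then obtain k r n where n: "0 < n" and r: "0 < r" "ball z0 r \<subseteq> unit_disc"
    and k: "k holomorphic_on ball z0 r"
    and gk: "\<And>w. w \<in> ball z0 r \<Longrightarrow> g w = (w - z0) ^ n * k w"
    and kn: "\<And>w. w \<in> ball z0 r \<Longrightarrow> k w \<noteq> 0"
    by (rule holomorphic_factor_zero_nonconstant[OF g open_ball connected_ball z0 gz]) blast
  define q where "q = (\<lambda>w. of_nat n + (w - z0) * deriv k w / k w)"
  have kz: "k z0 \<noteq> 0" using kn r by simp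
  have ck: "isCont k z0" "isCont (deriv k) z0" "isCont h z0"
    using cont[OF k] cont[OF holomorphic_deriv[OF k]] cont[OF h] r z0 by auto
  have q_lim: "q \<midarrow>z0\<rightarrow> of_nat n"
  proof -
    have "isCont q z0" unfolding q_def using ck kz by (intro continuous_intros) auto
    then show ?thesis by (simp add: q_def isCont_def)
  qed
  have h_lim: "(\<lambda>w. (w - z0) * h w / w) \<midarrow>z0\<rightarrow> 0"
  proof -
    have "isCont (\<lambda>w. (w - z0) * h w / w) z0"
      using ck z0n by (intro continuous_intros) auto
    then show ?thesis by (simp add: isCont_def)
  qed
  have eq: "q w = (w - z0) * h w / w" if w: "w \<in> ball z0 r - {z0, 0}" for w
  proof -
    have w': "w \<in> ball z0 r" "w \<noteq> z0" "w \<noteq> 0" using w by auto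
    have dk: "(k has_field_derivative deriv k w) (at w)"
      using holomorphic_derivI[OF k _ w'(1)] by simp
    have "((\<lambda>w. (w - z0) ^ n * k w) has_field_derivative
        of_nat n * (w - z0) ^ (n - 1) * k w + (w - z0) ^ n * deriv k w) (at w)"
      by (rule derivative_eq_intros dk refl | simp)+
    then have "(g has_field_derivative
        of_nat n * (w - z0) ^ (n - 1) * k w + (w - z0) ^ n * deriv k w) (at w)"
      by (rule has_field_derivative_transform_within_open[OF _ open_ball w'(1)]) (simp add: gk)
    then have "deriv g w = of_nat n * (w - z0) ^ (n - 1) * k w + (w - z0) ^ n * deriv k w"
      by (rule DERIV_imp_deriv)
    moreover obtain m where m: "n = Suc m" using n gr0_implies_Suc by blast
    moreover define d where "d = w - z0"
    ultimately have dg: "deriv g w = of_nat n * d ^ m * k w + d ^ Suc m * deriv k w"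
      and gw: "g w = d ^ Suc m * k w" using gk[OF w'(1)] by simp_all
    have d: "d \<noteq> 0" and kw: "k w \<noteq> 0" using w' kn by (simp_all add: d_def)
    have "(w - z0) * h w / w = d * deriv g w / g w"
      using w' by (simp add: h_def d_def)
    also have "\<dots> = q w"
      using d kw unfolding dg gw q_def d_def[symmetric] by (simp add: field_simps)
    finally show ?thesis by simp
  qed
  have "\<forall>\<^sub>F w in at z0. w \<in> ball z0 r - {z0, 0}"
  proof -
    have "\<forall>\<^sub>F w in at z0. w \<in> ball z0 r - {0} - {z0}"
      using r z0n by (intro eventually_at_in_open) auto
    then show ?thesis by (rule eventually_mono) auto
  qed
  then have "\<forall>\<^sub>F w in at z0. q w = (w - z0) * h w / w"
    by (rule eventually_mono) (rule eq)
  then have "q \<midarrow>z0\<rightarrow> 0"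
    using h_lim by (simp add: tendsto_cong)
  then show False
    using LIM_unique[OF q_lim, of 0] n by simp
qed

end

theory Submission
  imports Defs
begin

text \<open>
  If \<open>z f''/f' = F \<alpha> (\<omega> z)\<close>, the Schwarz lemma \<open>|\<omega> z| \<le> |z|\<close> gives
  \<open>|P\<^sub>f z| \<le> 1 / (1 - \<alpha> |z|\<^sup>2)\<close> for \<open>z \<noteq> 0\<close>, whence the bound; the origin follows by continuity.
  Equality occurs at the origin for the solution of \<open>g''/g' = 1 / (1 - \<alpha> z\<^sup>2)\<close>, where \<open>\<omega> z = z\<close>.
\<close>

text \<open>Reverse triangle inequality. On the disc the lower bound is positive when 0 \<le>
  \<alpha> \<le> 1, so it both excludes poles of \<open>F \<alpha>\<close> and controls its
  size.\<close>

lemma norm_F_denominator_ge: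
  fixes \<alpha> :: real
  assumes "0 \<le> \<alpha>"
  shows "1 - \<alpha> * (cmod w)\<^sup>2 \<le> cmod (1 - of_real \<alpha> * w\<^sup>2)"
  using norm_triangle_ineq2[of 1 "of_real \<alpha> * w\<^sup>2"] assms
  by (simp add: norm_mult norm_power)

lemma F_denominator_pos:
  fixes \<alpha> :: real
  assumes "0 \<le> \<alpha>" "\<alpha> \<le> 1" "w \<in> unit_disc"
  shows "0 < 1 - \<alpha> * (cmod w)\<^sup>2"
proof -
  have "\<alpha> * (cmod w)\<^sup>2 \<le> (cmod w)\<^sup>2"
    using assms by (simp add: mult_left_le_one_le)
  also have "\<dots> < 1"
    using assms by (simp add: power_less_one_iff)
  finally show ?thesis by simp
qed

lemma F_denominator_nonzero:
  fixes \<alpha> :: real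
  assumes "0 \<le> \<alpha>" "\<alpha> \<le> 1" "w \<in> unit_disc"
  shows "1 - of_real \<alpha> * w\<^sup>2 \<noteq> 0"
  using F_denominator_pos[OF assms] norm_F_denominator_ge[OF assms(1), of w] by auto

text \<open>The majorant is \<open>F \<alpha>\<close> at the real point |z|: passing from |w| up to
  |z| enlarges the numerator and shrinks the lower bound for the denominator, which stays
  positive.\<close>

lemma norm_F_le:
  fixes \<alpha> :: real
  assumes "0 \<le> \<alpha>" "\<alpha> \<le> 1" "z \<in> unit_disc" "cmod w \<le> cmod z"
  shows "cmod (F \<alpha> w) \<le> cmod z / (1 - \<alpha> * (cmod z)\<^sup>2)"
proof -
  have "\<alpha> * (cmod w)\<^sup>2 \<le> \<alpha> * (cmod z)\<^sup>2"
    using assms by (intro mult_left_mono power_mono) auto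
  then have "1 - \<alpha> * (cmod z)\<^sup>2 \<le> cmod (1 - of_real \<alpha> * w\<^sup>2)"
    using norm_F_denominator_ge[OF assms(1), of w] by simp
  then show ?thesis
    unfolding F_def norm_divide
    using assms F_denominator_pos[OF assms(1-3)] by (intro frac_le) auto
qed

text \<open>The quotient has no poles by \<open>BK_deriv_nonzero\<close>. This supplies the
  continuity at 0 with which the bound is extended to the origin.\<close>

lemma pre_schwarzian_holomorphic:
  assumes "f \<in> BK \<alpha>"
  shows "pre_schwarzian f holomorphic_on unit_disc"
proof -
  have "f holomorphic_on unit_disc"
    using assms by (simp add: BK_def class_A_def)
  then have "(\<lambda>z. deriv (deriv f) z / deriv f z) holomorphic_on unit_disc"
    using BK_deriv_nonzero[OF assms]
    by (intro holomorphic_on_divide holomorphic_deriv) auto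
  then show ?thesis
    by (simp add: pre_schwarzian_def[abs_def])
qed

text \<open>Subordination controls only z times the pre-Schwarzian, so a factor |z| has to be
  cancelled; hence the origin is left out here.\<close>

lemma pre_schwarzian_bound_nonzero:
  fixes \<alpha> :: real
  assumes \<alpha>: "0 \<le> \<alpha>" "\<alpha> \<le> 1" and f: "f \<in> BK \<alpha>" and z: "z \<in> unit_disc" "z \<noteq> 0"
  shows "(1 - (cmod z)\<^sup>2) * cmod (pre_schwarzian f z) \<le> 1"
proof -
  obtain \<omega> where \<omega>: "\<omega> holomorphic_on unit_disc" "\<omega> ` unit_disc \<subseteq> unit_disc" "\<omega> 0 = 0"
    and eq: "\<And>z. z \<in> unit_disc \<Longrightarrow> z * deriv (deriv f) z / deriv f z = F \<alpha> (\<omega> z)"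
    using f unfolding BK_def subordinate_def by auto
  have "cmod (\<omega> z) \<le> cmod z"
    using \<omega> z by (intro Schwarz_Lemma(1)) (auto simp: image_subset_iff)
  then have "cmod (F \<alpha> (\<omega> z)) \<le> cmod z / (1 - \<alpha> * (cmod z)\<^sup>2)"
    by (rule norm_F_le[OF \<alpha> z(1)])
  moreover have "F \<alpha> (\<omega> z) = z * pre_schwarzian f z"
    using eq[OF z(1)] by (simp add: pre_schwarzian_def)
  ultimately have "cmod z * cmod (pre_schwarzian f z) \<le> cmod z * (1 / (1 - \<alpha> * (cmod z)\<^sup>2))"
    by (simp add: norm_mult)
  then have P: "cmod (pre_schwarzian f z) \<le> 1 / (1 - \<alpha> * (cmod z)\<^sup>2)"
    using z(2) by (subst (asm) mult_le_cancel_left_pos) auto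
  \<comment> \<open>Since \<alpha> \<le> 1, the weight of the norm is at most the denominator of the
    bound \<open>P\<close>, so their product is at most 1.\<close>
  have "1 - (cmod z)\<^sup>2 \<le> 1 - \<alpha> * (cmod z)\<^sup>2"
    using \<alpha> by (simp add: mult_left_le_one_le)
  then have "(1 - (cmod z)\<^sup>2) * cmod (pre_schwarzian f z)
      \<le> (1 - \<alpha> * (cmod z)\<^sup>2) * (1 / (1 - \<alpha> * (cmod z)\<^sup>2))"
    using P F_denominator_pos[OF \<alpha> z(1)] by (intro mult_mono) auto
  also have "\<dots> = 1"
    using F_denominator_pos[OF \<alpha> z(1)] by simp
  finally show ?thesis .
qed

lemma pre_schwarzian_bound:
  fixes \<alpha> :: real
  assumes \<alpha>: "0 \<le> \<alpha>" "\<alpha> \<le> 1" and f: "f \<in> BK \<alpha>" and z: "z \<in> unit_disc"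
  shows "(1 - (cmod z)\<^sup>2) * cmod (pre_schwarzian f z) \<le> 1"
proof (cases "z = 0")
  case False
  then show ?thesis
    using pre_schwarzian_bound_nonzero[OF \<alpha> f z] by blast
next
  case True
  have "isCont (pre_schwarzian f) 0"
    using holomorphic_on_imp_continuous_on[OF pre_schwarzian_holomorphic[OF f]]
    by (simp add: continuous_on_eq_continuous_at)
  then have "isCont (\<lambda>z. (1 - (cmod z)\<^sup>2) * cmod (pre_schwarzian f z)) 0"
    by (intro continuous_intros)
  moreover have "\<forall>\<^sub>F z in at 0. (1 - (cmod z)\<^sup>2) * cmod (pre_schwarzian f z) \<le> 1"
  proof -
    have "\<forall>\<^sub>F z::complex in at 0. z \<in> unit_disc - {0}"
      by (intro eventually_at_in_open) auto
    then show ?thesis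
      by (rule eventually_mono) (use pre_schwarzian_bound_nonzero[OF \<alpha> f] in auto)
  qed
  \<comment> \<open>A weak inequality on a punctured neighbourhood of 0 passes to the limit, which
    by continuity is the value at 0.\<close>
  ultimately show ?thesis
    unfolding isCont_def True by (rule tendsto_upperbound) simp
qed

lemma pre_schwarzian_norm_le_one:
  fixes \<alpha> :: real
  assumes "0 \<le> \<alpha>" "\<alpha> \<le> 1" "f \<in> BK \<alpha>"
  shows "pre_schwarzian_norm f \<le> 1"
  unfolding pre_schwarzian_norm_def
  using pre_schwarzian_bound[OF assms] by (intro SUP_least) simp

lemma holomorphic_primitive_vanishing_at_0:
  assumes "u holomorphic_on unit_disc"
  obtains U where "U 0 = 0" "\<And>z. z \<in> unit_disc \<Longrightarrow> (U has_field_derivative u z) (at z)"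
proof -
  obtain V where V: "\<And>z. z \<in> unit_disc \<Longrightarrow> (V has_field_derivative u z) (at z within unit_disc)"
    using holomorphic_convex_primitive'[OF convex_ball open_ball assms] by blast
  show ?thesis
  proof
    show "((\<lambda>z. V z - V 0) has_field_derivative u z) (at z)" if "z \<in> unit_disc" for z
      using V[OF that] that
      by (auto simp: at_within_open[OF _ open_ball] intro!: derivative_eq_intros)
  qed simp
qed

text \<open>Two integrations solve g''/g' = p: first \<open>h\<close> as a logarithm of g', then
  \<open>g\<close> as a primitive of exp h. Taking both primitives to vanish at 0 gives the
  normalisation g(0) = 0, g'(0) = 1, and exp h has no zeros.\<close>

lemma class_A_with_pre_schwarzian:
  assumes p: "p holomorphic_on unit_disc"
  obtains g where "g \<in> class_A" "\<And>z. z \<in> unit_disc \<Longrightarrow> pre_schwarzian g z = p z"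
proof -
  obtain h where h0: "h 0 = 0"
    and h: "\<And>z. z \<in> unit_disc \<Longrightarrow> (h has_field_derivative p z) (at z)"
    using holomorphic_primitive_vanishing_at_0[OF p] by blast
  have "h holomorphic_on unit_disc"
    using h holomorphic_on_open[OF open_ball] by blast
  then have "(\<lambda>z. exp (h z)) holomorphic_on unit_disc"
    by (intro holomorphic_intros)
  then obtain g where g0: "g 0 = 0"
    and g: "\<And>z. z \<in> unit_disc \<Longrightarrow> (g has_field_derivative exp (h z)) (at z)"
    using holomorphic_primitive_vanishing_at_0 by blast
  have g': "deriv g z = exp (h z)" if "z \<in> unit_disc" for z
    using g[OF that] by (rule DERIV_imp_deriv)
  \<comment> \<open>\<open>deriv g\<close> is known to agree with exp h only on the disc; openness
    of the disc lets the derivative carry over.\<close>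
  have g'': "deriv (deriv g) z = exp (h z) * p z" if "z \<in> unit_disc" for z
  proof (rule DERIV_imp_deriv, rule has_field_derivative_transform_within_open[OF _ open_ball that])
    show "((\<lambda>z. exp (h z)) has_field_derivative exp (h z) * p z) (at z)"
      using h[OF that] by (auto intro!: derivative_eq_intros)
  qed (simp add: g')
  have "g holomorphic_on unit_disc"
    using g holomorphic_on_open[OF open_ball] by blast
  show ?thesis
  proof
    show "g \<in> class_A"
      using \<open>g holomorphic_on unit_disc\<close> g0 g'[of 0] h0 by (simp add: class_A_def)
    show "pre_schwarzian g z = p z" if "z \<in> unit_disc" for z
      using that by (simp add: pre_schwarzian_def g' g'')
  qed
qed

lemma BK_extremal:
  fixes \<alpha> :: real
  assumes \<alpha>: "0 \<le> \<alpha>" "\<alpha> \<le> 1"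
  obtains g where "g \<in> BK \<alpha>" "pre_schwarzian g 0 = 1"
proof -
  \<comment> \<open>This is F(z)/z with the singularity at 0 removed, so that z p(z) = F(z)
    everywhere and p(0) = 1.\<close>
  define p where "p z = 1 / (1 - of_real \<alpha> * z\<^sup>2)" for z :: complex
  have "p holomorphic_on unit_disc"
    unfolding p_def using F_denominator_nonzero[OF \<alpha>] by (intro holomorphic_intros) auto
  then obtain g where g: "g \<in> class_A" and P: "\<And>z. z \<in> unit_disc \<Longrightarrow> pre_schwarzian g z = p z"
    using class_A_with_pre_schwarzian by blast
  have F: "F \<alpha> holomorphic_on unit_disc"
    unfolding F_def[abs_def] using F_denominator_nonzero[OF \<alpha>] by (intro holomorphic_intros) auto
  have eq: "z * deriv (deriv g) z / deriv g z = F \<alpha> z" if "z \<in> unit_disc" for z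
  proof -
    have "z * pre_schwarzian g z = z * p z"
      using P[OF that] by simp
    then show ?thesis
      by (simp add: pre_schwarzian_def p_def F_def)
  qed
  have "(\<lambda>z. z * deriv (deriv g) z / deriv g z) \<prec>\<^sub>s F \<alpha>"
    unfolding subordinate_def
  \<comment> \<open>The quotient equals \<open>F \<alpha>\<close> itself on the disc, so the
    identity serves as the subordinating map and holomorphy is inherited from
    \<open>F \<alpha>\<close>.\<close>
  proof (intro conjI exI[of _ "\<lambda>z. z"])
    show "(\<lambda>z. z * deriv (deriv g) z / deriv g z) holomorphic_on unit_disc"
      using F eq by (subst holomorphic_cong[OF refl eq])
  qed (use F eq in auto)
  then have "g \<in> BK \<alpha>"
    using g by (simp add: BK_def)
  then show ?thesis
    using that P[of 0] by (simp add: p_def)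
qed

theorem theorem4p1:
  fixes \<alpha> :: real
  assumes "0 \<le> \<alpha>" and "\<alpha> \<le> 1"
  shows "(\<forall>f \<in> BK \<alpha>. pre_schwarzian_norm f \<le> 1) \<and>
         (\<exists>g \<in> BK \<alpha>. pre_schwarzian_norm g = 1)"
proof
  show bound: "\<forall>f \<in> BK \<alpha>. pre_schwarzian_norm f \<le> 1"
    using pre_schwarzian_norm_le_one[OF assms] by blast
  obtain g where g: "g \<in> BK \<alpha>" "pre_schwarzian g 0 = 1"
    using BK_extremal[OF assms] by blast
  \<comment> \<open>At the origin the weight is 1, so this single point already forces the supremum
    up to the bound.\<close>
  have "ereal ((1 - (cmod 0)\<^sup>2) * cmod (pre_schwarzian g 0)) \<le> pre_schwarzian_norm g"
    unfolding pre_schwarzian_norm_def by (rule SUP_upper) simp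
  then have "1 \<le> pre_schwarzian_norm g"
    by (simp add: g(2) one_ereal_def)
  with bound g(1) show "\<exists>g \<in> BK \<alpha>. pre_schwarzian_norm g = 1"
    by (auto intro: antisym)
qed

end
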